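(* Let $(x_j,y_j)\in\mathbb{R}_{\ge 0}^m\times\mathbb{R}_{\ge 0}^s$ ($j=1,\dots,n$) be input-output data with $x_j\ne 0$, $y_j\ne0$, let $o\in\{1,\dots,n\}$, $0\le L\le 1\le U\le\infty$, and let $g=(g^-,-g^+)$ with $g^-\in\mathbb{R}_{\ge 0}^m$, $g^+\in\mathbb{R}_{\ge 0}^s$ be the direction vector. Suppose each $g_i^-$ has the same unit of measurement as the $i$th input and each $g_r^+$ has the same unit as the $r$th output; that is, whenever the data are rescaled to $x'_{ij}=c_i x_{ij}$, $y'_{rj}=d_r y_{rj}$ for all $i,r,j$, with constants $c_i>0$, $d_r>0$, the direction vector becomes $g'=(g'^-,-g'^+)$ with $g'^-_i=c_i g_i^-$ and $g'^+_r=d_r g_r^+$. Then the super-efficiency measures $\rho_o^F$ and $\rho_o^L$ are unit invariant: for every such choice of $c_i>0$, $d_r>0$, the value $\rho_o^F(g')$ computed from the data $(x'_j,y'_j)_{j}$ equals $\rho_o^F(g)$ computed from $(x_j,y_j)_j$, and likewise the value(s) of $\rho_o^L(g')$ computed from $(x'_j,y'_j)_j$ coincide with the value(s) of $\rho_o^L(g)$ computed from $(x_j,y_j)_j$.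
   Context: $\mathrm{DMU}_j$ denotes the decision making unit with inputs $x_j=(x_{1j},\dots,x_{mj})$ and outputs $y_j=(y_{1j},\dots,y_{sj})$; $\mathrm{DMU}_o$ is under evaluation and $J=\{1,\dots,n\}\setminus\{o\}$ is the reference set. Given data and a direction $g$, consider the constraints $$\sum_{j\in J}\lambda_j x_{ij}\le x_{io}+\tau_i^- g_i^-\ (i=1,\dots,m),\qquad \sum_{j\in J}\lambda_j y_{rj}\ge y_{ro}-\tau_r^+ g_r^+\ (r=1,\dots,s),$$ $$L\le\sum_{j\in J}\lambda_j\le U,\qquad \lambda_j,\tau_i^-,\tau_r^+\ge 0\ \text{ for all } j,i,r.\qquad ( * )$$ - Fractional GDSE measure: $\rho_o^F(g)$ is the minimum (infimum) of $\dfrac{1+\frac1m\sum_i\tau_i^-}{1-\frac1s\sum_r\tau_r^+}$ over points satisfying $( * )$ with positive denominator ($\frac1s\sum_r\tau_r^+<1$); it is $+\infty$ if there are no such points. - Linear GDSE measure: the Linear GDSE model minimizes $\frac1m\sum_i\tau_i^-+\frac1s\sum_r\tau_r^+$ subject to $( * )$. Given an optimal solution $(\lambda_j^*,\tau_i^{-*},\tau_r^{+*})$ of it with $\frac1s\sum_r\tau_r^{+*}<1$, one sets $$\rho_o^L(g)=\Bigl[1+\tfrac1m\sum_{i=1}^m\tau_i^{-*}\Bigr]\Bigl[1-\tfrac1s\sum_{r=1}^s\tau_r^{+*}\Bigr]^{-1}.$$ Since the optimal solution may be non-unique, "the value(s) of $\rho_o^L(g)$" means the set of all numbers obtained in this way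 from optimal solutions. *)

theory Defs
  imports "HOL-Analysis.Analysis"
begin

text \<open>
  The \<open>m\<close> inputs, \<open>s\<close> outputs and \<open>n\<close> DMUs are indexed by the finite types \<open>'m\<close>, \<open>'s\<close>, \<open>'n\<close>.
  The direction vector \<open>(g\<^sup>-, -g\<^sup>+)\<close> is given by its two nonnegative parts \<open>gm\<close> and \<open>gp\<close>,
  and the DMU under evaluation is called \<open>k\<close>, since \<open>o\<close> is reserved syntax for composition.
  The upper bound \<open>U\<close> is extended real, as it may be infinite.

  Only the weights \<open>lam j\<close> with \<open>j \<noteq> k\<close> are variables of the model; \<open>lam k\<close> is
  unconstrained and does not occur in the constraints or in the objectives.
\<close>

definition gdse_feasible ::
  "('n::finite \<Rightarrow> real ^ 'm) \<Rightarrow> ('n \<Rightarrow> real ^ 's) \<Rightarrow> 'n \<Rightarrow> real \<Rightarrow> ereal \<Rightarrow>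
   real ^ 'm \<Rightarrow> real ^ 's \<Rightarrow> ('n \<Rightarrow> real) \<Rightarrow> real ^ 'm \<Rightarrow> real ^ 's \<Rightarrow> bool" where
  "gdse_feasible x y k L U gm gp lam tm tp \<longleftrightarrow>
     (\<forall>i. (\<Sum>j\<in>UNIV - {k}. lam j * x j $ i) \<le> x k $ i + tm $ i * gm $ i) \<and>
     (\<forall>r. (\<Sum>j\<in>UNIV - {k}. lam j * y j $ r) \<ge> y k $ r - tp $ r * gp $ r) \<and>
     L \<le> (\<Sum>j\<in>UNIV - {k}. lam j) \<and> ereal (\<Sum>j\<in>UNIV - {k}. lam j) \<le> U \<and>
     (\<forall>j\<in>UNIV - {k}. lam j \<ge> 0) \<and> (\<forall>i. tm $ i \<ge> 0) \<and> (\<forall>r. tp $ r \<ge> 0)"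

definition avg :: "real ^ 'a::finite \<Rightarrow> real" where
  "avg t = 1 / real CARD('a) * (\<Sum>i\<in>UNIV. t $ i)"

text \<open>The infimum of the empty set in \<^typ>\<open>ereal\<close> is \<open>\<infinity>\<close>, as required in the infeasible case.\<close>

definition rho_F ::
  "('n::finite \<Rightarrow> real ^ 'm::finite) \<Rightarrow> ('n \<Rightarrow> real ^ 's::finite) \<Rightarrow> 'n \<Rightarrow> real \<Rightarrow> ereal \<Rightarrow>
   real ^ 'm \<Rightarrow> real ^ 's \<Rightarrow> ereal" where
  "rho_F x y k L U gm gp =
     Inf {ereal ((1 + avg tm) / (1 - avg tp)) | lam tm tp.
            gdse_feasible x y k L U gm gp lam tm tp \<and> avg tp < 1}"

definition linear_gdse_optimal ::
  "('n::finite \<Rightarrow> real ^ 'm::finite) \<Rightarrow> ('n \<Rightarrow> real ^ 's::finite) \<Rightarrow> 'n \<Rightarrow> real \<Rightarrow> ereal \<Rightarrow>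
   real ^ 'm \<Rightarrow> real ^ 's \<Rightarrow> ('n \<Rightarrow> real) \<Rightarrow> real ^ 'm \<Rightarrow> real ^ 's \<Rightarrow> bool" where
  "linear_gdse_optimal x y k L U gm gp lam tm tp \<longleftrightarrow>
     gdse_feasible x y k L U gm gp lam tm tp \<and>
     (\<forall>lam' tm' tp'. gdse_feasible x y k L U gm gp lam' tm' tp' \<longrightarrow>
        avg tm + avg tp \<le> avg tm' + avg tp')"

text \<open>Optimal solutions need not be unique, so the linear measure is the set of all its values.\<close>

definition rho_L_values ::
  "('n::finite \<Rightarrow> real ^ 'm::finite) \<Rightarrow> ('n \<Rightarrow> real ^ 's::finite) \<Rightarrow> 'n \<Rightarrow> real \<Rightarrow> ereal \<Rightarrow>
   real ^ 'm \<Rightarrow> real ^ 's \<Rightarrow> real set" where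
  "rho_L_values x y k L U gm gp =
     {(1 + avg tm) * inverse (1 - avg tp) | lam tm tp.
        linear_gdse_optimal x y k L U gm gp lam tm tp \<and> avg tp < 1}"

end

theory Submission
  imports Defs
begin

text \<open>
  Rescaling multiplies each input constraint by \<open>c\<^sub>i > 0\<close> and each output constraint by
  \<open>d\<^sub>r > 0\<close>, so the feasible set is literally unchanged. Both measures depend on the data
  only through that set.
\<close>

lemma gdse_feasible_rescale:
  fixes x x' :: "'n::finite \<Rightarrow> real ^ 'm" and y y' :: "'n \<Rightarrow> real ^ 's"
  assumes c: "\<And>i. c $ i > 0" and d: "\<And>r. d $ r > 0"
    and x': "\<And>j i. x' j $ i = c $ i * x j $ i"
    and y': "\<And>j r. y' j $ r = d $ r * y j $ r"
    and gm': "\<And>i. gm' $ i = c $ i * gm $ i"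
    and gp': "\<And>r. gp' $ r = d $ r * gp $ r"
  shows "gdse_feasible x' y' k L U gm' gp' = gdse_feasible x y k L U gm gp"
proof (intro ext)
  fix lam tm tp
  have "(\<Sum>j\<in>UNIV - {k}. lam j * x' j $ i) \<le> x' k $ i + tm $ i * gm' $ i \<longleftrightarrow>
        (\<Sum>j\<in>UNIV - {k}. lam j * x j $ i) \<le> x k $ i + tm $ i * gm $ i" for i
  proof -
    have "(\<Sum>j\<in>UNIV - {k}. lam j * x' j $ i) = c $ i * (\<Sum>j\<in>UNIV - {k}. lam j * x j $ i)"
      by (simp add: x' sum_distrib_left mult.left_commute)
    \<comment> \<open>The direction carries the unit of its input, so \<open>tm $ i\<close> is
      dimensionless: the slack term picks up the factor \<open>c $ i\<close> with \<open>tm\<close>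
      itself unchanged.\<close>
    moreover have "x' k $ i + tm $ i * gm' $ i = c $ i * (x k $ i + tm $ i * gm $ i)"
      by (simp add: x' gm' algebra_simps)
    ultimately show ?thesis
      using c by (simp only: mult_le_cancel_left_pos)
  qed
  moreover have "(\<Sum>j\<in>UNIV - {k}. lam j * y' j $ r) \<ge> y' k $ r - tp $ r * gp' $ r \<longleftrightarrow>
        (\<Sum>j\<in>UNIV - {k}. lam j * y j $ r) \<ge> y k $ r - tp $ r * gp $ r" for r
  proof -
    have "(\<Sum>j\<in>UNIV - {k}. lam j * y' j $ r) = d $ r * (\<Sum>j\<in>UNIV - {k}. lam j * y j $ r)"
      by (simp add: y' sum_distrib_left mult.left_commute)
    moreover have "y' k $ r - tp $ r * gp' $ r = d $ r * (y k $ r - tp $ r * gp $ r)"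
      by (simp add: y' gp' algebra_simps)
    \<comment> \<open>Since \<open>\<ge>\<close> abbreviates a flipped \<open>\<le>\<close>, the
      cancellation of a positive factor used for the inputs applies here too.\<close>
    ultimately show ?thesis
      using d by (simp only: mult_le_cancel_left_pos)
  qed
  \<comment> \<open>The remaining constraints bound the total weight and fix signs; they contain no
    data and agree syntactically.\<close>
  ultimately show "gdse_feasible x' y' k L U gm' gp' lam tm tp =
      gdse_feasible x y k L U gm gp lam tm tp"
    by (simp only: gdse_feasible_def)
qed

theorem theorem4p3p3:
  fixes x x' :: "'n::finite \<Rightarrow> real ^ 'm::finite"
    and y y' :: "'n \<Rightarrow> real ^ 's::finite"
    and gm gm' c :: "real ^ 'm"
    and gp gp' d :: "real ^ 's"
    and k :: 'n
    and L :: real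
    and U :: ereal
  assumes "\<And>j i. x j $ i \<ge> 0" and "\<And>j r. y j $ r \<ge> 0"
    and "\<And>j. x j \<noteq> 0" and "\<And>j. y j \<noteq> 0"
    and "0 \<le> L" and "L \<le> 1" and "1 \<le> U"
    and "\<And>i. gm $ i \<ge> 0" and "\<And>r. gp $ r \<ge> 0"
    and "\<And>i. c $ i > 0" and "\<And>r. d $ r > 0"
    and "\<And>j i. x' j $ i = c $ i * x j $ i"
    and "\<And>j r. y' j $ r = d $ r * y j $ r"
    and "\<And>i. gm' $ i = c $ i * gm $ i"
    and "\<And>r. gp' $ r = d $ r * gp $ r"
  shows "rho_F x' y' k L U gm' gp' = rho_F x y k L U gm gp \<and>
         rho_L_values x' y' k L U gm' gp' = rho_L_values x y k L U gm gp"
proof -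
  have "gdse_feasible x' y' k L U gm' gp' = gdse_feasible x y k L U gm gp"
    using assms(10-15) by (rule gdse_feasible_rescale)
  \<comment> \<open>As an equation between unapplied predicates, the fact rewrites under the set
    comprehensions and also for the competitors \<open>lam'\<close>, \<open>tm'\<close>,
    \<open>tp'\<close> in the optimality condition. The objectives involve only \<open>tm\<close>
    and \<open>tp\<close>, so they need no rescaling.\<close>
  then show ?thesis
    by (simp only: rho_F_def rho_L_values_def linear_gdse_optimal_def)
qed

end
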